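(* Let $\{x_i\}_{i=1}^m$ be a frame for $\mathbb{R}^n$, let $P:\mathbb{R}^n\to\mathbb{R}^n$ be an orthogonal projection, let $Y=P(\mathbb{R}^n)$ and $Z=(I-P)(\mathbb{R}^n)$, and let $\{a_i\}_{i=1}^m,\{b_i\}_{i=1}^m$ be real scalars. Let $T_1,T_2:\mathbb{R}^n\to\ell_2(m)$ be the analysis operators of $\{Px_i\}_{i=1}^m$ (on $Y$) and $\{(I-P)x_i\}_{i=1}^m$ (on $Z$), extended by zero to the orthogonal complements of $Y$ and $Z$ respectively. Let $D_1,D_2$ be the diagonal operators on $\ell_2(m)$ with diagonal entries $\{a_i\}_{i=1}^m$ and $\{b_i\}_{i=1}^m$, respectively. The following are equivalent: (1) $\{x_i\}_{i=1}^m$ is piecewise scalable with the projection $P$ and scaling constants $\{a_i,b_i\}_{i=1}^m$. (2) $T_1^*D_1^2T_1=I_Y$, $\ T_2^*D_2^2T_2=I_Z$, and $T_1^*D_1D_2T_2=T_2^*D_2D_1T_1=0$.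
   Context: A finite family $\{x_i\}_{i=1}^m$ in a finite-dimensional real inner product space $H$ is a frame for $H$ if there are constants $0<A\le B<\infty$ with $A\|x\|^2\le\sum_{i=1}^m|\langle x,x_i\rangle|^2\le B\|x\|^2$ for all $x\in H$; it is a Parseval frame for $H$ if $\sum_{i=1}^m|\langle x,x_i\rangle|^2=\|x\|^2$ for all $x\in H$. The analysis operator of $\{x_i\}_{i=1}^m$ is $T:H\to\ell_2(m)$, $Tx=\{\langle x,x_i\rangle\}_{i=1}^m$, where $\ell_2(m)$ is $\mathbb{R}^m$ with its Euclidean inner product. An orthogonal projection is a linear map $P$ with $P\circ P=P$ and $P^*=P$. A frame $\{x_i\}_{i=1}^m$ for $\mathbb{R}^n$ is piecewise scalable with an orthogonal projection $P$ and scaling constants $\{a_i,b_i\}_{i=1}^m\subset\mathbb{R}$ if $\{a_iPx_i+b_i(I-P)x_i\}_{i=1}^m$ is a Parseval frame for $\mathbb{R}^n$. For a subspace $V$ of $\mathbb{R}^n$, $I_V:\mathbb{R}^n\to\mathbb{R}^n$ is the operator that is the identity on $V$ and zero on $V^\perp$. *)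

theory Defs
  imports "HOL-Analysis.Analysis"
begin

text \<open>A family indexed by \<open>{1..m}\<close> is a function on a finite type \<open>'m\<close>; the space
  $\ell_2(m)$ is \<open>real ^ 'm\<close>, and the ambient space $H$ is the type \<open>'a\<close>.\<close>

definition is_frame :: "('m::finite \<Rightarrow> 'a::euclidean_space) \<Rightarrow> bool" where
  "is_frame x \<longleftrightarrow> (\<exists>A B. 0 < A \<and> A \<le> B \<and>
     (\<forall>v. A * (norm v)\<^sup>2 \<le> (\<Sum>i\<in>UNIV. \<bar>v \<bullet> x i\<bar>\<^sup>2) \<and> (\<Sum>i\<in>UNIV. \<bar>v \<bullet> x i\<bar>\<^sup>2) \<le> B * (norm v)\<^sup>2))"

definition parseval_frame :: "('m::finite \<Rightarrow> 'a::euclidean_space) \<Rightarrow> bool" where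
  "parseval_frame x \<longleftrightarrow> (\<forall>v. (\<Sum>i\<in>UNIV. \<bar>v \<bullet> x i\<bar>\<^sup>2) = (norm v)\<^sup>2)"

definition analysis_op :: "('m::finite \<Rightarrow> 'a::euclidean_space) \<Rightarrow> 'a \<Rightarrow> real ^ 'm" where
  "analysis_op x v = (\<chi> i. v \<bullet> x i)"

definition orthogonal_projection :: "('a::euclidean_space \<Rightarrow> 'a) \<Rightarrow> bool" where
  "orthogonal_projection P \<longleftrightarrow> linear P \<and> P \<circ> P = P \<and> adjoint P = P"

definition piecewise_scalable ::
  "('m::finite \<Rightarrow> real ^ 'n) \<Rightarrow> (real ^ 'n \<Rightarrow> real ^ 'n) \<Rightarrow> ('m \<Rightarrow> real) \<Rightarrow> ('m \<Rightarrow> real) \<Rightarrow> bool" where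
  "piecewise_scalable x P a b \<longleftrightarrow> is_frame x \<and> orthogonal_projection P \<and>
     parseval_frame (\<lambda>i. a i *\<^sub>R P (x i) + b i *\<^sub>R (x i - P (x i)))"

definition diag_op :: "('m::finite \<Rightarrow> real) \<Rightarrow> real ^ 'm \<Rightarrow> real ^ 'm" where
  "diag_op d v = (\<chi> i. d i * v $ i)"

text \<open>Extension by zero to the orthogonal complement of \<open>V\<close> of an operator \<open>T\<close> given on the
  subspace \<open>V\<close>: the vector \<open>w = v + u\<close> with \<open>v\<close> in \<open>V\<close> and \<open>u\<close> orthogonal to \<open>V\<close> is sent to
  \<open>T v\<close>. The values of \<open>T\<close> outside \<open>V\<close> are irrelevant.\<close>

definition zero_ext :: "'a::euclidean_space set \<Rightarrow> ('a \<Rightarrow> 'b) \<Rightarrow> 'a \<Rightarrow> 'b" where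
  "zero_ext V T w = T (THE v. v \<in> V \<and> w - v \<in> V\<^sup>\<bottom>)"

definition id_on_subspace :: "'a::euclidean_space set \<Rightarrow> 'a \<Rightarrow> 'a" where
  "id_on_subspace V = zero_ext V id"

lemma zero_ext_eq:
  fixes V :: "'a::euclidean_space set"
  assumes "subspace V" "v \<in> V" "u \<in> V\<^sup>\<bottom>"
  shows "zero_ext V T (v + u) = T v"
proof -
  have "(THE v'. v' \<in> V \<and> v + u - v' \<in> V\<^sup>\<bottom>) = v"
  proof (rule the_equality)
    fix v' assume *: "v' \<in> V \<and> v + u - v' \<in> V\<^sup>\<bottom>"
    have "v - v' \<in> V"
      using * assms by (simp add: subspace_diff)
    moreover have "(v + u - v') - u \<in> V\<^sup>\<bottom>"
      using * assms(3) subspace_diff[OF subspace_orthogonal_comp] by blast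
    hence "v - v' \<in> V\<^sup>\<bottom>" by simp
    ultimately have "orthogonal (v - v') (v - v')"
      by (auto simp: orthogonal_comp_def)
    thus "v' = v" by (simp add: orthogonal_def)
  qed (use assms in simp)
  thus ?thesis by (simp add: zero_ext_def)
qed

lemma zero_ext_on:
  assumes "subspace V" "v \<in> V"
  shows "zero_ext V T v = T v"
  using zero_ext_eq[OF assms, of 0 T] subspace_0[OF subspace_orthogonal_comp[of V]] by simp

lemma zero_ext_orthogonal_comp:
  assumes "subspace V" "u \<in> V\<^sup>\<bottom>"
  shows "zero_ext V T u = T 0"
  using zero_ext_eq[OF assms(1) subspace_0[OF assms(1)] assms(2), of T] by simp

end

theory Submission
  imports Defs
begin

text \<open>With \<open>Q = I - P\<close>, the analysis operator of the family of vectors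
  \<open>a\<^sub>i P x\<^sub>i + b\<^sub>i Q x\<^sub>i\<close> is the sum of \<open>A = D\<^sub>1 T\<^sub>1\<close> and \<open>B = D\<^sub>2 T\<^sub>2\<close>, where \<open>A = A P\<close>
  and \<open>B = B Q\<close>. The family is Parseval iff \<open>A + B\<close> is an isometry. Polarizing and evaluating
  the bilinear form on pairs from the ranges of \<open>P\<close> and \<open>Q\<close> isolates the four blocks
  \<open>A\<^sup>* A\<close>, \<open>B\<^sup>* B\<close>, \<open>A\<^sup>* B\<close> and \<open>B\<^sup>* A\<close>, which must be \<open>P\<close>, \<open>Q\<close>, \<open>0\<close> and \<open>0\<close>.\<close>

lemma orthogonal_projection_inner:
  fixes P :: "'a::euclidean_space \<Rightarrow> 'a"
  assumes "orthogonal_projection P"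
  shows "P v \<bullet> w = v \<bullet> P w"
  using assms adjoint_works[of P v w] by (simp add: orthogonal_projection_def)

lemma orthogonal_projection_idem:
  assumes "orthogonal_projection P"
  shows "P (P v) = P v"
  using assms unfolding orthogonal_projection_def by (metis comp_apply)

text \<open>This makes the facts about \<open>P\<close> and \<open>range P\<close> available for
  \<open>I - P\<close> and its range.\<close>

lemma orthogonal_projection_complement:
  fixes P :: "'a::euclidean_space \<Rightarrow> 'a"
  assumes "orthogonal_projection P"
  shows "orthogonal_projection (\<lambda>v. v - P v)"
  unfolding orthogonal_projection_def
proof (intro conjI)
  have lin: "linear P"
    using assms by (simp add: orthogonal_projection_def)
  show "linear (\<lambda>v. v - P v)"
    by (intro linear_compose_sub lin linear_ident)
  show "(\<lambda>v. v - P v) \<circ> (\<lambda>v. v - P v) = (\<lambda>v. v - P v)"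
    by (simp add: fun_eq_iff linear_diff[OF lin] orthogonal_projection_idem[OF assms])
  show "adjoint (\<lambda>v. v - P v) = (\<lambda>v. v - P v)"
    by (rule adjoint_unique)
      (simp add: inner_diff_left inner_diff_right orthogonal_projection_inner[OF assms])
qed

text \<open>In \<open>v = P v + (v - P v)\<close> the second summand is orthogonal to
  \<open>range P\<close>, by self-adjointness and idempotence, so the description in
  \<open>zero_ext\<close> picks out \<open>P v\<close>.\<close>

lemma zero_ext_range_orthogonal_projection:
  fixes P :: "'a::euclidean_space \<Rightarrow> 'a"
  assumes "orthogonal_projection P"
  shows "zero_ext (range P) T = T \<circ> P"
proof
  fix v
  have lin: "linear P"
    using assms by (simp add: orthogonal_projection_def)
  have "v - P v \<in> (range P)\<^sup>\<bottom>"
    by (auto simp: orthogonal_comp_def orthogonal_def orthogonal_projection_inner[OF assms]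
        linear_diff[OF lin] orthogonal_projection_idem[OF assms])
  then show "zero_ext (range P) T v = (T \<circ> P) v"
    using zero_ext_eq[of "range P" "P v" "v - P v" T] linear_subspace_image[OF lin subspace_UNIV]
    by simp
qed

text \<open>Extending by zero precomposes with \<open>P\<close>, which is invisible here: moving
  \<open>P\<close> across the inner product only applies it a second time to
  \<open>P (x i)\<close>.\<close>

lemma zero_ext_analysis_op:
  fixes x :: "'m::finite \<Rightarrow> 'a::euclidean_space"
  assumes "orthogonal_projection P"
  shows "zero_ext (range P) (analysis_op (\<lambda>i. P (x i))) = analysis_op (\<lambda>i. P (x i))"
  by (simp add: zero_ext_range_orthogonal_projection[OF assms] fun_eq_iff analysis_op_def
      orthogonal_projection_inner[OF assms] orthogonal_projection_idem[OF assms])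

lemma linear_analysis_op: "linear (analysis_op x)"
  by (rule linearI) (simp_all add: analysis_op_def vec_eq_iff inner_add_left)

lemma inner_diag_op: "diag_op d v \<bullet> w = v \<bullet> diag_op d w"
  by (simp add: diag_op_def inner_vec_def ac_simps)

lemma parseval_frame_iff_norm_analysis_op:
  "parseval_frame x \<longleftrightarrow> (\<forall>v. norm (analysis_op x v) = norm v)"
proof -
  have "(\<Sum>i\<in>UNIV. \<bar>v \<bullet> x i\<bar>\<^sup>2) = (norm (analysis_op x v))\<^sup>2" for v
    unfolding power2_norm_eq_inner
    by (simp add: inner_vec_def analysis_op_def power2_eq_square)
  then show ?thesis
    by (simp add: parseval_frame_def)
qed

text \<open>Translates the operator identities of condition (2) into identities of bilinear forms,
  where the blocks can be compared.\<close>

lemma adjoint_comp_eq_iff: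
  fixes S :: "'a::euclidean_space \<Rightarrow> 'b::euclidean_space"
  assumes "linear S"
  shows "adjoint S \<circ> M = R \<longleftrightarrow> (\<forall>w v. S w \<bullet> M v = w \<bullet> R v)"
proof
  assume "adjoint S \<circ> M = R"
  then show "\<forall>w v. S w \<bullet> M v = w \<bullet> R v"
    using adjoint_works[OF assms] by auto
next
  assume *: "\<forall>w v. S w \<bullet> M v = w \<bullet> R v"
  show "adjoint S \<circ> M = R"
  proof
    fix v
    have "w \<bullet> adjoint S (M v) = w \<bullet> R v" for w
      using * adjoint_works[OF assms] by simp
    then show "(adjoint S \<circ> M) v = R v"
      using vector_eq_ldot by auto
  qed
qed

text \<open>Polarization: the inner product of \<open>w\<close> and \<open>v\<close> is determined
  by the norms of \<open>w\<close>, \<open>v\<close> and \<open>w + v\<close>, and linearity turns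
  \<open>L w + L v\<close> into \<open>L (w + v)\<close>.\<close>

lemma linear_norm_preserving_iff_inner:
  fixes L :: "'a::real_inner \<Rightarrow> 'b::real_inner"
  assumes "linear L"
  shows "(\<forall>v. norm (L v) = norm v) \<longleftrightarrow> (\<forall>w v. L w \<bullet> L v = w \<bullet> v)"
proof
  assume "\<forall>v. norm (L v) = norm v"
  then show "\<forall>w v. L w \<bullet> L v = w \<bullet> v"
    by (simp add: dot_norm flip: linear_add[OF assms])
qed (simp add: norm_eq_sqrt_inner)

lemma norm_preserving_iff_blocks:
  fixes A B :: "'a::euclidean_space \<Rightarrow> 'b::euclidean_space"
  assumes P: "orthogonal_projection P"
    and "linear A" "linear B"
    and AP: "\<And>v. A (P v) = A v"
    and BP: "\<And>v. B (P v) = 0"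
  shows "(\<forall>v. norm (A v + B v) = norm v) \<longleftrightarrow>
    (\<forall>w v. A w \<bullet> A v = w \<bullet> P v) \<and> (\<forall>w v. B w \<bullet> B v = w \<bullet> (v - P v)) \<and>
    (\<forall>w v. A w \<bullet> B v = 0) \<and> (\<forall>w v. B w \<bullet> A v = 0)" (is "?L \<longleftrightarrow> ?R")
proof -
  have AQ: "A (v - P v) = 0" for v
    by (simp add: linear_diff[OF \<open>linear A\<close>] AP)
  have BQ: "B (v - P v) = B v" for v
    by (simp add: linear_diff[OF \<open>linear B\<close>] BP)
  have "linear (\<lambda>v. A v + B v)"
    by (intro linear_compose_add assms)
  then have L: "?L \<longleftrightarrow> (\<forall>w v. (A w + B w) \<bullet> (A v + B v) = w \<bullet> v)"
    by (rule linear_norm_preserving_iff_inner)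
  show ?thesis
  proof
    assume ?L
    then have *: "(A w + B w) \<bullet> (A v + B v) = w \<bullet> v" for w v
      using L by blast
    note idem = orthogonal_projection_idem[OF P]
    note sym = orthogonal_projection_inner[OF P]
    show ?R
    proof (intro conjI allI)
      fix w v
      \<comment> \<open>Since \<open>A\<close> vanishes on the range of \<open>I - P\<close> and
        \<open>B\<close> on that of \<open>P\<close>, projecting both arguments leaves one of the
        four products. For mixed pairs the right side is 0, as the two ranges are
        orthogonal.\<close>
      show "A w \<bullet> A v = w \<bullet> P v"
        using *[of "P w" "P v"] by (simp add: AP BP sym idem)
      show "B w \<bullet> B v = w \<bullet> (v - P v)"
        using *[of "w - P w" "v - P v"]
        by (simp add: AQ BQ sym idem inner_diff_left inner_diff_right)
      show "A w \<bullet> B v = 0"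
        using *[of "P w" "v - P v"] by (simp add: AP BP AQ BQ sym idem inner_diff_right)
      show "B w \<bullet> A v = 0"
        using *[of "w - P w" "P v"] by (simp add: AP BP AQ BQ sym idem inner_diff_left)
    qed
  next
    \<comment> \<open>Conversely, the four blocks add up to the inner product of \<open>w\<close>
      with \<open>P v + (v - P v) = v\<close>.\<close>
    assume ?R
    then show ?L
      unfolding L by (simp add: inner_add_left inner_add_right inner_diff_right)
  qed
qed

theorem theorem2p8:
  fixes x :: "'m::finite \<Rightarrow> real ^ 'n"
    and P :: "real ^ 'n \<Rightarrow> real ^ 'n"
    and a b :: "'m \<Rightarrow> real"
    and Y Z :: "(real ^ 'n) set"
    and T1 T2 :: "real ^ 'n \<Rightarrow> real ^ 'm"
    and D1 D2 :: "real ^ 'm \<Rightarrow> real ^ 'm"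
  assumes "is_frame x"
    and "orthogonal_projection P"
    and "Y = range P"
    and "Z = range (\<lambda>v. v - P v)"
    and "T1 = zero_ext Y (analysis_op (\<lambda>i. P (x i)))"
    and "T2 = zero_ext Z (analysis_op (\<lambda>i. x i - P (x i)))"
    and "D1 = diag_op a"
    and "D2 = diag_op b"
  shows "piecewise_scalable x P a b \<longleftrightarrow>
    adjoint T1 \<circ> (D1 ^^ 2) \<circ> T1 = id_on_subspace Y \<and>
    adjoint T2 \<circ> (D2 ^^ 2) \<circ> T2 = id_on_subspace Z \<and>
    adjoint T1 \<circ> D1 \<circ> D2 \<circ> T2 = (\<lambda>v. 0) \<and>
    adjoint T2 \<circ> D2 \<circ> D1 \<circ> T1 = (\<lambda>v. 0)"
proof -
  note P = \<open>orthogonal_projection P\<close>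
  note Q = orthogonal_projection_complement[OF P]
  note sym = orthogonal_projection_inner[OF P]
  note idem = orthogonal_projection_idem[OF P]
  have T1: "T1 = analysis_op (\<lambda>i. P (x i))"
    using zero_ext_analysis_op[OF P, of x] assms by simp
  have T2: "T2 = analysis_op (\<lambda>i. x i - P (x i))"
    using zero_ext_analysis_op[OF Q, of x] assms by simp
  have IY: "id_on_subspace Y = P"
    by (simp add: assms(3,4) id_on_subspace_def zero_ext_range_orthogonal_projection[OF P])
  have IZ: "id_on_subspace Z = (\<lambda>v. v - P v)"
    by (simp add: assms(3,4) id_on_subspace_def zero_ext_range_orthogonal_projection[OF Q])
  have lin: "linear T1" "linear T2"
    by (simp_all add: T1 T2 linear_analysis_op)
  define A where "A = (\<lambda>v. D1 (T1 v))"
  define B where "B = (\<lambda>v. D2 (T2 v))"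
  have linA: "linear A" and linB: "linear B"
    unfolding A_def B_def T1 T2 assms(7,8)
    by (rule linearI; simp add: diag_op_def analysis_op_def vec_eq_iff inner_add_left algebra_simps)+
  have AP: "A (P v) = A v" for v
    by (simp add: A_def T1 analysis_op_def sym idem)
  have BP: "B (P v) = 0" for v
    by (simp add: B_def T2 analysis_op_def assms(8) diag_op_def sym idem inner_diff_right
        vec_eq_iff)
  have "analysis_op (\<lambda>i. a i *\<^sub>R P (x i) + b i *\<^sub>R (x i - P (x i))) v = A v + B v" for v
    by (simp add: A_def B_def T1 T2 assms(7,8) analysis_op_def diag_op_def vec_eq_iff
        inner_add_right)
  then have "piecewise_scalable x P a b \<longleftrightarrow> (\<forall>v. norm (A v + B v) = norm v)"
    using assms(1,2) by (simp add: piecewise_scalable_def parseval_frame_iff_norm_analysis_op)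
  also have "\<dots> \<longleftrightarrow>
    (\<forall>w v. A w \<bullet> A v = w \<bullet> P v) \<and> (\<forall>w v. B w \<bullet> B v = w \<bullet> (v - P v)) \<and>
    (\<forall>w v. A w \<bullet> B v = 0) \<and> (\<forall>w v. B w \<bullet> A v = 0)"
    by (rule norm_preserving_iff_blocks[OF P linA linB AP BP])
  \<comment> \<open>Self-adjointness of the diagonal operators moves the left factor across: the
    inner product of \<open>A w\<close> and \<open>A v\<close> becomes that of \<open>T1 w\<close>
    and \<open>(D1 ^^ 2) (T1 v)\<close>, and the other blocks behave likewise.\<close>
  finally show ?thesis
    by (simp add: IY IZ comp_assoc adjoint_comp_eq_iff lin A_def B_def assms(7,8)
        inner_diag_op numeral_2_eq_2)
qed

end
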